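(* Let $r>0$ and let $X\ge 0$ be an integer valued random variable such that $\mathbb{E}X=r(1-p)/p$ for some $0<p<1$. Then $X\sim\mathrm{NB}(r,p)$ if and only if $X$ is equal in distribution to $X^{*_r}$, where $X^{*_r}$ has the $r$-equilibrium distribution of $X$.
   Context: For $r>0$, $0<p\le 1$, $X\sim\mathrm{NB}(r,p)$ means $\mathbb{P}(X=k)=\frac{\Gamma(r+k)}{k!\,\Gamma(r)}(1-p)^kp^r$, $k=0,1,\ldots$. Pólya urn variables: for $r>0$ and integers $n\ge 1$, $U_{r,n}$ is the number of white balls drawn in $n-1$ draws from a standard Pólya urn started with $r$ "white balls" and $1$ black ball; that is, $U_{r,1}=0$ and for $k\ge 1$, $\mathbb{P}(U_{r,k+1}=U_{r,k}+1\mid U_{r,k})=1-\mathbb{P}(U_{r,k+1}=U_{r,k}\mid U_{r,k})=\frac{r+U_{r,k}}{r+k}$. Size bias: for a non-negative integer valued $X$ with finite (positive) mean, $X^s$ has the size bias distribution of $X$ if $\mathbb{P}(X^s=k)=k\,\mathbb{P}(X=k)/\mathbb{E}X$, $k=1,2,\ldots$. $r$-equilibrium: $X^{*_r}$ has the $r$-equilibrium distribution (transformation) of $X$ if $X^{*_r}$ is equal in distribution to $U_{r,X^s}$, where $\mathscr{L}(U_{r,X^s}\mid X^s=k)=\mathscr{L}(U_{r,k})$ ($\mathscr{L}$ denotes law). *)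

theory Defs
  imports "HOL-Probability.Probability"
begin

text \<open>Random variables are \<open>nat\<close>-valued and measurable into \<open>count_space UNIV\<close>; their laws are
  represented by \<open>nat pmf\<close>.\<close>

definition NB_distributed :: "'a measure \<Rightarrow> ('a \<Rightarrow> nat) \<Rightarrow> real \<Rightarrow> real \<Rightarrow> bool" where
  "NB_distributed M X r p \<longleftrightarrow>
     (\<forall>k. \<P>(\<omega> in M. X \<omega> = k) =
        Gamma (r + real k) / (fact k * Gamma r) * (1 - p) ^ k * p powr r)"

text \<open>\<open>polya_urn_pmf r n\<close> is the law of $U_{r,n}$, built from its transition probabilities; a step
  from $U_{r,k} = u$ with \<open>k = Suc n\<close> adds a white ball with probability $(r+u)/(r+k)$. The index
  starts at 1, so the value at 0 is a dummy. Since $U_{r,k} \leq k - 1$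
  (\<open>set_polya_urn_pmf\<close> below), for $r > 0$ the Bernoulli parameter always lies in $[0,1]$.\<close>

fun polya_urn_pmf :: "real \<Rightarrow> nat \<Rightarrow> nat pmf" where
  "polya_urn_pmf r 0 = return_pmf 0"
| "polya_urn_pmf r (Suc 0) = return_pmf 0"
| "polya_urn_pmf r (Suc (Suc n)) =
     bind_pmf (polya_urn_pmf r (Suc n)) (\<lambda>u.
       map_pmf (\<lambda>white. if white then Suc u else u)
         (bernoulli_pmf ((r + real u) / (r + real (Suc n)))))"

lemma set_polya_urn_pmf: "set_pmf (polya_urn_pmf r (Suc n)) \<subseteq> {..n}"
proof (induction n)
  case (Suc n)
  then show ?case by (fastforce split: if_splits)
qed simp

text \<open>Meaningful when \<open>X\<close> has finite positive mean; see \<open>pmf_size_bias_pmf\<close>. The mass at 0 is 0.\<close>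

definition size_bias_pmf :: "'a measure \<Rightarrow> ('a \<Rightarrow> nat) \<Rightarrow> nat pmf" where
  "size_bias_pmf M X =
     embed_pmf (\<lambda>k. real k * \<P>(\<omega> in M. X \<omega> = k) / (\<integral>\<omega>. real (X \<omega>) \<partial>M))"

lemma pmf_size_bias_pmf:
  assumes "prob_space M" and X: "X \<in> M \<rightarrow>\<^sub>M count_space UNIV"
    and int: "integrable M (\<lambda>\<omega>. real (X \<omega>))" and pos: "0 < (\<integral>\<omega>. real (X \<omega>) \<partial>M)"
  shows "pmf (size_bias_pmf M X) k =
           real k * \<P>(\<omega> in M. X \<omega> = k) / (\<integral>\<omega>. real (X \<omega>) \<partial>M)"
proof -
  interpret prob_space M by fact
  define m where "m = (\<integral>\<omega>. real (X \<omega>) \<partial>M)"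
  have m: "m > 0" using pos by (simp add: m_def)
  have P: "emeasure (distr M (count_space UNIV) X) {j} = ennreal (\<P>(\<omega> in M. X \<omega> = j))" for j
    using X by (subst emeasure_distr)
      (auto simp: emeasure_eq_measure vimage_def Int_def conj_commute)
  have D: "distr M (count_space UNIV) X =
      density (count_space UNIV) (\<lambda>j. emeasure (distr M (count_space UNIV) X) {j})"
    by (rule measure_eqI_countable[where A = UNIV]) (auto simp: emeasure_density)
  have "(\<integral>\<^sup>+j. ennreal (real j * \<P>(\<omega> in M. X \<omega> = j) / m) \<partial>count_space UNIV)
      = (\<integral>\<^sup>+j. emeasure (distr M (count_space UNIV) X) {j} * ennreal (real j / m)
           \<partial>count_space UNIV)"
    using m by (intro nn_integral_cong)
      (simp add: P ennreal_mult[symmetric] mult.commute)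
  also have "\<dots> = (\<integral>\<^sup>+j. ennreal (real j / m) \<partial>distr M (count_space UNIV) X)"
    by (subst (2) D) (simp add: nn_integral_density)
  also have "\<dots> = (\<integral>\<^sup>+\<omega>. ennreal (real (X \<omega>) / m) \<partial>M)"
    using X by (simp add: nn_integral_distr)
  also have "\<dots> = ennreal (\<integral>\<omega>. real (X \<omega>) / m \<partial>M)"
    using int m by (intro nn_integral_eq_integral) auto
  also have "\<dots> = 1"
    using m by (simp add: m_def)
  finally show ?thesis
    unfolding size_bias_pmf_def m_def[symmetric]
    using m by (intro pmf_embed_pmf) auto
qed

text \<open>The law of $U_{r,X^s}$: draw $k$ from the size bias law of \<open>X\<close>, then $U_{r,k}$.\<close>

definition equilibrium_pmf :: "real \<Rightarrow> 'a measure \<Rightarrow> ('a \<Rightarrow> nat) \<Rightarrow> nat pmf" where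
  "equilibrium_pmf r M X = bind_pmf (size_bias_pmf M X) (polya_urn_pmf r)"

definition has_equilibrium_distribution ::
  "real \<Rightarrow> 'a measure \<Rightarrow> ('a \<Rightarrow> nat) \<Rightarrow> 'b measure \<Rightarrow> ('b \<Rightarrow> nat) \<Rightarrow> bool" where
  "has_equilibrium_distribution r M X N Y \<longleftrightarrow>
     distr N (count_space UNIV) Y = measure_pmf (equilibrium_pmf r M X)"

end

theory Submission
  imports Defs
begin

text \<open>
  Write \<open>q k\<close> for the mass of \<open>X\<close> at \<open>k\<close>. The urn variable has the beta-binomial law
  \[ P(U_{r,n+1} = j) = r \, \frac{\Gamma(r+j)}{j!} \, \frac{n!}{\Gamma(r+n+1)}, \qquad j \leq n, \]
  in which \<open>j\<close> and \<open>n\<close> are separated (\<open>pmf_polya_urn_pmf_Suc\<close>). Averaging over the size bias law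
  multiplies this by $(n+1) q(n+1) / E X$, so with the normalised masses
  $a(k) = k! \, q(k) / \Gamma(r+k)$ and $E X = r (1-p)/p$ the mass of $X^{*_r}$ at $j$ is
  \[ \frac{\Gamma(r+j)}{j!} \, \frac{p}{1-p} \sum_{k > j} a(k) \]
  (\<open>equilibrium_pmf_tail_sums\<close>). Hence \<open>X\<close> has the law of $X^{*_r}$ iff every $a(j)$ is
  $p/(1-p)$ times the tail of \<open>a\<close> beyond \<open>j\<close>. That says that each tail is $1-p$ times the
  preceding one, which characterises geometric sequences of ratio $1-p$
  (\<open>geometric_iff_tail_sums\<close>). Finally, $a$ is geometric of ratio $1-p$ iff \<open>q\<close> is
  proportional to the negative binomial masses, and the constant is forced by the total mass
  being 1, through the binomial series for $(1-(1-p))^{-r}$ (\<open>negative_binomial_series\<close>).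
\<close>

section \<open>The law of the urn variable\<close>

lemma pmf_map_bernoulli_step:
  assumes "0 \<le> t" "t \<le> 1"
  shows "pmf (map_pmf (\<lambda>white. if white then Suc u else u) (bernoulli_pmf t)) j =
           (if Suc u = j then t else 0) + (if u = j then 1 - t else 0)"
proof -
  have "map_pmf (\<lambda>white. if white then Suc u else u) (bernoulli_pmf t) =
        bind_pmf (bernoulli_pmf t) (\<lambda>white. return_pmf (if white then Suc u else u))"
    by (simp add: map_pmf_def)
  then show ?thesis
    using assms by (auto simp: pmf_bind)
qed

lemma pmf_polya_urn_pmf_step:
  assumes r: "r > 0"
  shows "pmf (polya_urn_pmf r (Suc (Suc n))) j =
           (if j = 0 then 0
            else pmf (polya_urn_pmf r (Suc n)) (j - 1) * ((r + real (j - 1)) / (r + real (Suc n))))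
           + pmf (polya_urn_pmf r (Suc n)) j * (1 - (r + real j) / (r + real (Suc n)))"
proof -
  let ?P = "polya_urn_pmf r (Suc n)"
  let ?t = "\<lambda>u. (r + real u) / (r + real (Suc n))"
  have supp: "u \<le> n" if "u \<in> set_pmf ?P" for u
    using that set_polya_urn_pmf[of r n] by auto
  have out: "pmf ?P u = 0" if "u > n" for u
    using that supp[of u] by (auto simp: set_pmf_iff simp del: polya_urn_pmf.simps)
  have "pmf (polya_urn_pmf r (Suc (Suc n))) j =
        (\<Sum>u\<le>n. pmf (map_pmf (\<lambda>white. if white then Suc u else u) (bernoulli_pmf (?t u))) j
          * pmf ?P u)"
    using supp by (simp only: polya_urn_pmf.simps pmf_bind, subst integral_measure_pmf_real[of "{..n}"])
      (auto simp del: polya_urn_pmf.simps)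
  also have "\<dots> = (\<Sum>u\<le>n. (if Suc u = j then pmf ?P u * ?t u else 0)
                      + (if u = j then pmf ?P u * (1 - ?t u) else 0))"
    using r by (intro sum.cong refl, subst pmf_map_bernoulli_step)
      (auto simp: field_simps simp del: polya_urn_pmf.simps)
  also have "\<dots> = (if j = 0 then 0 else pmf ?P (j - 1) * ?t (j - 1)) + pmf ?P j * (1 - ?t j)"
  proof -
    have "(\<Sum>u\<le>n. if Suc u = j then pmf ?P u * ?t u else 0) =
          (if j = 0 then 0 else pmf ?P (j - 1) * ?t (j - 1))"
      using out by (cases j) (auto simp del: polya_urn_pmf.simps)
    moreover have "(\<Sum>u\<le>n. if u = j then pmf ?P u * (1 - ?t u) else 0) = pmf ?P j * (1 - ?t j)"
      using out by (auto simp del: polya_urn_pmf.simps)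
    ultimately show ?thesis
      by (simp add: sum.distrib del: polya_urn_pmf.simps)
  qed
  finally show ?thesis .
qed

lemma Gamma_pos_shift:
  fixes r :: real
  assumes "r > 0"
  shows "Gamma (r + real k) > 0"
  using assms by (intro Gamma_real_pos) auto

lemma Gamma_add_Suc:
  fixes r :: real
  assumes "r > 0"
  shows "Gamma (r + real (Suc k)) = (r + real k) * Gamma (r + real k)"
proof -
  have "r + real k > 0" using assms by simp
  then have "r + real k \<notin> \<int>\<^sub>\<le>\<^sub>0" by (meson nonpos_Ints_nonpos not_le)
  then have "Gamma (r + real k + 1) = (r + real k) * Gamma (r + real k)" by (rule Gamma_plus1)
  moreover have "r + real (Suc k) = r + real k + 1" by simp
  ultimately show ?thesis by presburger
qed

text \<open>The two ways of reaching \<open>j\<close> white balls contribute in the ratio $j : (n+1-j)$, and these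
  weights add up to the factor \<open>n + 1\<close> that turns \<open>fact n\<close> into \<open>fact (Suc n)\<close>.\<close>

lemma pmf_polya_urn_pmf_Suc:
  assumes r: "r > 0"
  shows "pmf (polya_urn_pmf r (Suc n)) j =
           (if j \<le> n then r * (Gamma (r + real j) / fact j) * (fact n / Gamma (r + real (Suc n)))
            else 0)"
proof (induction n arbitrary: j)
  case 0
  have "Gamma (r + real (Suc 0)) = r * Gamma r"
    using Gamma_add_Suc[OF r, of 0] by simp
  moreover have "Gamma r \<noteq> 0"
    using Gamma_real_pos[OF r] by (rule less_imp_neq[symmetric])
  ultimately show ?case using r by (simp add: pmf_return del: of_nat_Suc)
next
  case (Suc n)
  (* F and c are the two separated factors of the law; D is the denominator of the urn step. *)
  define D where "D = r + real (Suc n)"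
  define c where "c = fact n / Gamma D"
  define F where "F i = Gamma (r + real i) / fact i" for i :: nat
  have D: "D > 0" using r by (simp add: D_def)
  have c': "fact (Suc n) / Gamma (r + real (Suc (Suc n))) = (real n + 1) * c / D"
    by (subst Gamma_add_Suc[OF r]) (simp add: c_def D_def mult_ac add_ac)
  have F_Suc: "(r + real i) * F i = real (Suc i) * F (Suc i)" for i
    unfolding F_def by (subst Gamma_add_Suc[OF r]) (simp del: of_nat_Suc)
  have IH: "pmf (polya_urn_pmf r (Suc n)) i = (if i \<le> n then r * F i * c else 0)" for i
    using Suc.IH[of i] unfolding F_def c_def D_def .
  (* At i = n + 1 both sides vanish, so the weight n + 1 - i needs no case distinction below. *)
  have stay: "pmf (polya_urn_pmf r (Suc n)) i * (1 - (r + real i) / D) =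
      r * F i * c * (real n + 1 - real i) / D" if "i \<le> Suc n" for i
  proof (cases "i = Suc n")
    case True
    then show ?thesis by (simp add: IH)
  next
    case False
    moreover have "1 - (r + real i) / D = (real n + 1 - real i) / D"
      using D by (simp add: field_simps) (simp add: D_def)
    ultimately show ?thesis using that by (simp add: IH)
  qed
  have "pmf (polya_urn_pmf r (Suc (Suc n))) j =
      (if j \<le> Suc n then r * F j * ((real n + 1) * c / D) else 0)"
  proof (cases j)
    case 0
    then show ?thesis
      using stay[of 0] unfolding pmf_polya_urn_pmf_step[OF r] D_def[symmetric] by simp
  next
    case (Suc i)
    show ?thesis
    proof (cases "i \<le> n")
      case True
      have "pmf (polya_urn_pmf r (Suc (Suc n))) j =
          r * F i * c * ((r + real i) / D) + r * F j * c * (real n + 1 - real j) / D"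
        using stay[of j] True IH[of i] Suc
        unfolding pmf_polya_urn_pmf_step[OF r] D_def[symmetric] by simp
      also have "r * F i * c * ((r + real i) / D) = r * c / D * ((r + real i) * F i)"
        by simp
      also have "\<dots> = r * c / D * (real j * F j)"
        unfolding F_Suc Suc ..
      also have "\<dots> + r * F j * c * (real n + 1 - real j) / D = r * F j * ((real n + 1) * c / D)"
        using D by (simp add: field_simps)
      finally show ?thesis using True Suc by simp
    next
      case False
      then show ?thesis
        using IH[of i] IH[of j] Suc unfolding pmf_polya_urn_pmf_step[OF r] by simp
    qed
  qed
  then show ?case unfolding c' F_def .
qed

section \<open>Tail sums and geometric sequences\<close>

text \<open>With $T_j = \sum_{k \geq j} a(k)$, the tail condition reads $T_{j+1} = \frac{1-p}{p} (T_j - T_{j+1})$,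
  that is $T_{j+1} = (1-p) T_j$, and $a(j) = p \, T_j$.\<close>

lemma geometric_iff_tail_sums:
  fixes a :: "nat \<Rightarrow> real"
  assumes p: "0 < p" "p < 1"
  shows "(\<forall>j. (\<lambda>i. a (Suc j + i)) sums ((1 - p) / p * a j)) \<longleftrightarrow> (\<forall>k. a k = a 0 * (1 - p) ^ k)"
proof
  assume tail: "\<forall>j. (\<lambda>i. a (Suc j + i)) sums ((1 - p) / p * a j)"
  have step: "a (Suc j) = (1 - p) * a j" for j
  proof -
    (* The tail beyond j is a (Suc j) plus the tail beyond Suc j; compare the values given by the
       tail condition at j and at Suc j. *)
    have "(\<lambda>i. a (Suc j + Suc i)) sums ((1 - p) / p * a (Suc j))"
      using tail[rule_format, of "Suc j"] by simp
    then have "(\<lambda>i. a (Suc j + i)) sums ((1 - p) / p * a (Suc j) + a (Suc j + 0))"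
      by (rule sums_Suc)
    then have "(1 - p) / p * a j = (1 - p) / p * a (Suc j) + a (Suc j)"
      using tail sums_unique2 by (metis add_0_right)
    then show ?thesis using p by (simp add: field_simps)
  qed
  show "\<forall>k. a k = a 0 * (1 - p) ^ k"
  proof
    show "a k = a 0 * (1 - p) ^ k" for k
      by (induction k) (auto simp: step)
  qed
next
  assume geo: "\<forall>k. a k = a 0 * (1 - p) ^ k"
  show "\<forall>j. (\<lambda>i. a (Suc j + i)) sums ((1 - p) / p * a j)"
  proof
    fix j
    have "(\<lambda>i. a 0 * (1 - p) ^ Suc j * (1 - p) ^ i) sums (a 0 * (1 - p) ^ Suc j * (1 / (1 - (1 - p))))"
      using p by (intro sums_mult geometric_sums) auto
    moreover have "a (Suc j + i) = a 0 * (1 - p) ^ Suc j * (1 - p) ^ i" for i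
      by (subst geo[rule_format]) (simp add: power_add)
    moreover have "(1 - p) / p * a j = a 0 * (1 - p) ^ Suc j * (1 / (1 - (1 - p)))"
      by (subst geo[rule_format]) simp
    ultimately show "(\<lambda>i. a (Suc j + i)) sums ((1 - p) / p * a j)"
      by (simp only:)
  qed
qed

lemma negative_binomial_series:
  fixes r p :: real
  assumes r: "r > 0" and p: "0 < p" "p < 1"
  shows "(\<lambda>k. Gamma (r + real k) / (fact k * Gamma r) * (1 - p) ^ k) sums (p powr - r)"
proof -
  have "(\<lambda>k. ((- r) gchoose k) * (- (1 - p)) ^ k) sums (1 + (- (1 - p))) powr (- r)"
    using p by (intro gen_binomial_real) auto
  moreover have "((- r) gchoose k) * (- (1 - p)) ^ k =
      Gamma (r + real k) / (fact k * Gamma r) * (1 - p) ^ k" for k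
  proof -
    have "pochhammer r k = Gamma (r + real k) / Gamma r"
      using r by (intro pochhammer_Gamma) (auto simp: nonpos_Ints_def)
    moreover have "(- (1 - p)) ^ k = (- 1) ^ k * (1 - p) ^ k"
      by (metis power_minus)
    moreover have "(- 1) ^ k * (- 1) ^ k = (1 :: real)"
      by (simp flip: power_mult_distrib)
    ultimately show ?thesis
      unfolding gbinomial_pochhammer by (simp add: mult_ac del: minus_diff_eq)
  qed
  ultimately show ?thesis by simp
qed

section \<open>Laws of integer valued random variables\<close>

lemma distr_eq_measure_pmf_iff:
  fixes X :: "'a \<Rightarrow> nat"
  assumes "prob_space M" and X: "X \<in> M \<rightarrow>\<^sub>M count_space UNIV"
  shows "distr M (count_space UNIV) X = measure_pmf Q \<longleftrightarrow> (\<forall>k. \<P>(\<omega> in M. X \<omega> = k) = pmf Q k)"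
proof -
  interpret prob_space M by fact
  have E: "emeasure (distr M (count_space UNIV) X) {k} = ennreal (\<P>(\<omega> in M. X \<omega> = k))" for k
    using X by (subst emeasure_distr)
      (auto simp: emeasure_eq_measure vimage_def Int_def conj_commute)
  show ?thesis
  proof
    assume "distr M (count_space UNIV) X = measure_pmf Q"
    then have "ennreal (\<P>(\<omega> in M. X \<omega> = k)) = ennreal (pmf Q k)" for k
      using E[of k] by (simp add: emeasure_pmf_single)
    then show "\<forall>k. \<P>(\<omega> in M. X \<omega> = k) = pmf Q k" by simp
  next
    assume "\<forall>k. \<P>(\<omega> in M. X \<omega> = k) = pmf Q k"
    then show "distr M (count_space UNIV) X = measure_pmf Q"
      by (intro measure_eqI_countable[where A = UNIV]) (auto simp: E emeasure_pmf_single)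
  qed
qed

lemma sums_point_masses:
  fixes X :: "'a \<Rightarrow> nat"
  assumes "prob_space M" and X: "X \<in> M \<rightarrow>\<^sub>M count_space UNIV"
  shows "(\<lambda>k. \<P>(\<omega> in M. X \<omega> = k)) sums 1"
proof -
  interpret prob_space M by fact
  have "(\<lambda>k. prob {\<omega> \<in> space M. X \<omega> = k}) sums prob (\<Union>k. {\<omega> \<in> space M. X \<omega> = k})"
    using X by (intro finite_measure_UNION) (auto simp: disjoint_family_on_def)
  moreover have "(\<Union>k. {\<omega> \<in> space M. X \<omega> = k}) = space M" by auto
  ultimately show ?thesis by (simp add: prob_space)
qed

text \<open>A formula for the mass of a mixture that also yields convergence of the series, which the
  tail sums of the normalised masses inherit.\<close>

lemma sums_pmf_bind_nat:
  fixes P :: "nat pmf"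
  shows "(\<lambda>k. pmf P k * pmf (f k) j) sums pmf (bind_pmf P f) j"
proof -
  have "ennreal (pmf (bind_pmf P f) j) = (\<Sum>k. ennreal (pmf P k * pmf (f k) j))"
    by (simp add: ennreal_pmf_bind nn_integral_measure_pmf nn_integral_count_space_nat
        ennreal_mult)
  then have "(\<lambda>k. ennreal (pmf P k * pmf (f k) j)) sums ennreal (pmf (bind_pmf P f) j)"
    by (simp add: summable_sums)
  then show ?thesis by (subst (asm) sums_ennreal) auto
qed

text \<open>The size bias factor \<open>k\<close> completes the \<open>fact (k - 1)\<close> of the urn law to \<open>fact k\<close>; the terms
  with \<open>k \<le> j\<close> vanish because fewer than \<open>k\<close> white balls are drawn.\<close>

lemma equilibrium_pmf_tail_sums:
  fixes X :: "'a \<Rightarrow> nat"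
  assumes r: "r > 0" and M: "prob_space M" and X: "X \<in> M \<rightarrow>\<^sub>M count_space UNIV"
    and int: "integrable M (\<lambda>\<omega>. real (X \<omega>))" and pos: "0 < (\<integral>\<omega>. real (X \<omega>) \<partial>M)"
  shows "(\<lambda>i. fact (Suc j + i) * \<P>(\<omega> in M. X \<omega> = Suc j + i) / Gamma (r + real (Suc j + i))) sums
           ((\<integral>\<omega>. real (X \<omega>) \<partial>M) / r *
             (fact j * pmf (equilibrium_pmf r M X) j / Gamma (r + real j)))"
proof -
  define m where "m = (\<integral>\<omega>. real (X \<omega>) \<partial>M)"
  define q where "q k = \<P>(\<omega> in M. X \<omega> = k)" for k
  define f where "f k = pmf (size_bias_pmf M X) k * pmf (polya_urn_pmf r k) j" for k
  (* C removes the factors that depend on j only from the mass of the equilibrium law. *)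
  define C where "C = m / r * (fact j / Gamma (r + real j))"
  have m: "m > 0" using pos by (simp add: m_def)
  have G: "Gamma (r + real j) > 0" by (rule Gamma_pos_shift[OF r])
  have sb: "pmf (size_bias_pmf M X) k = real k * q k / m" for k
    using pmf_size_bias_pmf[OF M X int pos] by (simp add: m_def q_def)
  have "f sums pmf (equilibrium_pmf r M X) j"
    unfolding f_def equilibrium_pmf_def by (rule sums_pmf_bind_nat)
  moreover have "f k = 0" if "k < Suc j" for k
    using that by (cases k)
      (auto simp: f_def sb pmf_polya_urn_pmf_Suc[OF r] simp del: polya_urn_pmf.simps(3))
  ultimately have "(\<lambda>i. f (i + Suc j)) sums pmf (equilibrium_pmf r M X) j"
    using sums_iff_shift[of f "Suc j" "pmf (equilibrium_pmf r M X) j"] by simp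
  then have "(\<lambda>i. C * f (i + Suc j)) sums (C * pmf (equilibrium_pmf r M X) j)"
    by (rule sums_mult)
  moreover have "C * f (i + Suc j) =
      fact (Suc j + i) * q (Suc j + i) / Gamma (r + real (Suc j + i))" for i
  proof -
    have "f (i + Suc j) = real (Suc (j + i)) * q (Suc (j + i)) / m *
        (r * (Gamma (r + real j) / fact j) * (fact (j + i) / Gamma (r + real (Suc (j + i)))))"
      by (simp add: f_def sb pmf_polya_urn_pmf_Suc[OF r] add.commute[of i]
          del: polya_urn_pmf.simps of_nat_Suc)
    then show ?thesis
      using m G[THEN less_imp_neq] r by (simp add: C_def del: of_nat_Suc)
  qed
  ultimately show ?thesis by (simp add: C_def m_def q_def mult.assoc)
qed

text \<open>A geometric shape of the normalised masses determines them completely, since the total mass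
  1 fixes the constant.\<close>

lemma NB_distributed_iff_geometric:
  fixes X :: "'a \<Rightarrow> nat"
  assumes r: "r > 0" and p: "0 < p" "p < 1"
    and M: "prob_space M" and X: "X \<in> M \<rightarrow>\<^sub>M count_space UNIV"
  defines "a \<equiv> \<lambda>k. fact k * \<P>(\<omega> in M. X \<omega> = k) / Gamma (r + real k)"
  shows "NB_distributed M X r p \<longleftrightarrow> (\<forall>k. a k = a 0 * (1 - p) ^ k)"
proof -
  define q where "q k = \<P>(\<omega> in M. X \<omega> = k)" for k
  define w where "w k = Gamma (r + real k) / (fact k * Gamma r) * (1 - p) ^ k" for k
  have pos: "Gamma (r + real k) > 0" for k
    by (rule Gamma_pos_shift[OF r])
  have w0: "w 0 = 1" using pos[of 0] by (simp add: w_def)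
  have NB: "NB_distributed M X r p \<longleftrightarrow> (\<forall>k. q k = p powr r * w k)"
    by (simp add: NB_distributed_def q_def w_def mult_ac)
  have "a k = a 0 * (1 - p) ^ k \<longleftrightarrow> q k = q 0 * w k" for k
    using pos[of k] pos[of 0] by (simp add: a_def q_def w_def field_simps)
  then have geo: "(\<forall>k. a k = a 0 * (1 - p) ^ k) \<longleftrightarrow> (\<forall>k. q k = q 0 * w k)" by simp
  have "q 0 = p powr r" if "\<forall>k. q k = q 0 * w k"
  proof -
    have "(\<lambda>k. q 0 * w k) sums (q 0 * p powr - r)"
      unfolding w_def by (intro sums_mult negative_binomial_series r p)
    moreover have "q = (\<lambda>k. q 0 * w k)" using that by blast
    then have "(\<lambda>k. q 0 * w k) sums 1"
      using sums_point_masses[OF M X] unfolding q_def[symmetric] by argo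
    ultimately have "q 0 * p powr - r = 1" by (rule sums_unique2)
    then show ?thesis using p by (simp add: powr_minus field_simps)
  qed
  moreover have "q 0 = p powr r" if "\<forall>k. q k = p powr r * w k"
    using that w0 by (metis mult.right_neutral)
  ultimately show ?thesis unfolding NB geo by metis
qed

section \<open>The characterisation\<close>

theorem corollary2p3:
  fixes r p :: real
    and M :: "'a measure" and X :: "'a \<Rightarrow> nat"
    and N :: "'b measure" and Xstar :: "'b \<Rightarrow> nat"
  assumes "r > 0" and "0 < p" and "p < 1"
    and "prob_space M" and "X \<in> M \<rightarrow>\<^sub>M count_space UNIV"
    and "integrable M (\<lambda>\<omega>. real (X \<omega>))"
    and "(\<integral>\<omega>. real (X \<omega>) \<partial>M) = r * (1 - p) / p"
    and "prob_space N" and "Xstar \<in> N \<rightarrow>\<^sub>M count_space UNIV"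
    and "has_equilibrium_distribution r M X N Xstar"
  shows "NB_distributed M X r p \<longleftrightarrow>
         distr M (count_space UNIV) X = distr N (count_space UNIV) Xstar"
proof -
  define a where "a k = fact k * \<P>(\<omega> in M. X \<omega> = k) / Gamma (r + real k)" for k
  define b where "b k = fact k * pmf (equilibrium_pmf r M X) k / Gamma (r + real k)" for k
  have mean: "0 < (\<integral>\<omega>. real (X \<omega>) \<partial>M)"
    using assms(1-3) by (simp add: assms(7))
  have tail: "(\<lambda>i. a (Suc j + i)) sums ((1 - p) / p * b j)" for j
    using equilibrium_pmf_tail_sums[OF assms(1,4,5,6) mean, of j] assms(1)
    by (simp add: a_def b_def assms(7))
  have "distr M (count_space UNIV) X = distr N (count_space UNIV) Xstar \<longleftrightarrow>
        (\<forall>k. \<P>(\<omega> in M. X \<omega> = k) = pmf (equilibrium_pmf r M X) k)"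
    using assms(10) distr_eq_measure_pmf_iff[OF assms(4,5)]
    by (simp add: has_equilibrium_distribution_def)
  also have "\<dots> \<longleftrightarrow> (\<forall>k. a k = b k)"
  proof -
    have "Gamma (r + real k) \<noteq> 0" for k
      using Gamma_pos_shift[OF assms(1), of k] by simp
    then show ?thesis by (simp add: a_def b_def)
  qed
  also have "\<dots> \<longleftrightarrow> (\<forall>j. (\<lambda>i. a (Suc j + i)) sums ((1 - p) / p * a j))"
  proof -
    have "a j = b j \<longleftrightarrow> (\<lambda>i. a (Suc j + i)) sums ((1 - p) / p * a j)" for j
    proof
      show "a j = b j" if "(\<lambda>i. a (Suc j + i)) sums ((1 - p) / p * a j)"
        using sums_unique2[OF that tail] assms(2,3) by simp
    qed (use tail[of j] in simp)
    then show ?thesis by simp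
  qed
  also have "\<dots> \<longleftrightarrow> (\<forall>k. a k = a 0 * (1 - p) ^ k)"
    using assms(2,3) by (rule geometric_iff_tail_sums)
  also have "\<dots> \<longleftrightarrow> NB_distributed M X r p"
    using NB_distributed_iff_geometric[OF assms(1-5)] by (simp add: a_def)
  finally show ?thesis by simp
qed

end
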